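(* Let $a_1,\dots,a_n$ be a collection of vectors in $\mathbb{R}^d$ which can be partitioned as $\mathcal{A}_1,\dots,\mathcal{A}_\ell$ with $\ell$ even, and let $r_i:=\dim(\operatorname{span}\{a: a\in\mathcal{A}_i\})$ for $1\le i\le \ell$. Let $\epsilon_1,\dots,\epsilon_n$ be independent Rademacher random variables. Then $$\sup_{u\in\mathbb{R}^d}\Pr\left[\sum_{i=1}^n\epsilon_i a_i=u\right]\le\left(2^{-\ell}\binom{\ell}{\ell/2}\right)^{\frac{r_1+\dots+r_\ell}{\ell}}\le\left(\sqrt{\frac{2}{\pi\ell}}\left(1+O\left(\frac1\ell\right)\right)\right)^{\frac{r_1+\dots+r_\ell}{\ell}},$$ where the implied constant in $O(1/\ell)$ is absolute.
   Context: A Rademacher random variable takes the values $+1$ and $-1$ with probability $1/2$ each. The collection $a_1,\dots,a_n$ is an indexed family (repetitions allowed), and a partition of it means a partition of the indices $\{1,\dots,n\}$ into $\ell$ classes. *)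

theory Defs
  imports "HOL-Analysis.Analysis" "HOL-Probability.Probability"
begin

definition rademacher :: "'m measure \<Rightarrow> ('m \<Rightarrow> real) \<Rightarrow> bool" where
  "rademacher M X \<longleftrightarrow>
     X \<in> borel_measurable M \<and>
     measure M {\<omega> \<in> space M. X \<omega> = 1} = 1/2 \<and>
     measure M {\<omega> \<in> space M. X \<omega> = -1} = 1/2"

text \<open>Repetitions among the vectors are allowed, so a partition of the family is a partition
  of its index set. Classes may be empty (they then have rank 0).\<close>
definition index_partition :: "nat \<Rightarrow> nat \<Rightarrow> (nat \<Rightarrow> nat set) \<Rightarrow> bool" where
  "index_partition n l A \<longleftrightarrow>
     disjoint_family_on A {1..l} \<and> (\<Union>j\<in>{1..l}. A j) = {1..n}"

end

(* Work with the averages of exp(i k t) over k < N, which converge to 1 if t is a multiple of 2 pi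
   and to 0 otherwise. For a vector v, the probability of hitting u is at most the limit of the
   averages of exp(-i k <u,v>) times the product of all cos(k <a_i,v>). Bound each class of cosines
   by those of a basis I_j of its span. By AM-GM (Hoelder's inequality with exponents l, normalised
   so that the limit is explicit) only the averages of the product of cos(k <a_b,v>)^l over b in I_j
   remain. If v is generic, linear independence makes these factors asymptotically independent, and
   the average tends to the r_j-th power of 2^(-l) (l choose l/2). The second inequality holds with
   C = 0, since m (4^(-m) (2m choose m))^2 increases to 1/pi by Wallis' product. *)

theory Submission
  imports Defs "HOL-Real_Asymp.Real_Asymp"
begin

section \<open>Averages of characters and generic directions\<close>

text \<open>If \<open>cis z\<close> is not 1, the geometric sums stay bounded by
  \<open>2 / norm (cis z - 1)\<close>, so division by \<open>N\<close> sends them to 0. Otherwise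
  every term is 1.\<close>

lemma cis_mean_tendsto:
  "(\<lambda>N. (\<Sum>n<N. cis (real n * z)) / of_nat N) \<longlonglongrightarrow> (if cis z = 1 then 1 else 0)"
proof (cases "cis z = 1")
  case True
  then have "cis (real n * z) = 1" for n
    by (metis Complex.DeMoivre power_one)
  then have "\<forall>\<^sub>F N in sequentially. (\<Sum>n<N. cis (real n * z)) / of_nat N = 1"
    by (auto intro: eventually_mono[OF eventually_gt_at_top[of 0]])
  then show ?thesis
    using True by (simp add: tendsto_eventually)
next
  case False
  have "norm ((\<Sum>n<N. cis (real n * z)) / of_nat N) \<le> 2 / norm (cis z - 1) * (1 / real N)" for N
  proof -
    have "(\<Sum>n<N. cis (real n * z)) = (cis z ^ N - 1) / (cis z - 1)"
      using geometric_sum[OF False] by (simp add: Complex.DeMoivre)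
    moreover have "norm (cis z ^ N - 1) \<le> 2"
      using norm_triangle_ineq4[of "cis z ^ N" 1] by (simp add: norm_power)
    ultimately show ?thesis
      using divide_right_mono[of "norm (cis z ^ N - 1)" 2 "norm (cis z - 1) * real N"]
      by (simp add: norm_divide norm_mult)
  qed
  moreover have "(\<lambda>N. 2 / norm (cis z - 1) * (1 / real N)) \<longlonglongrightarrow> 0"
    by (rule tendsto_mult_right_zero[OF lim_1_over_n])
  ultimately have "(\<lambda>N. (\<Sum>n<N. cis (real n * z)) / of_nat N) \<longlonglongrightarrow> 0"
    by (rule Lim_null_comparison[OF always_eventually, OF allI])
  then show ?thesis
    using False by simp
qed

lemma cis_eq_1_imp:
  assumes "cis x = 1"
  shows "\<exists>k::int. x = 2 * pi * of_int k"
proof -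
  have "cos x = 1"
    using arg_cong[OF assms, of Re] by simp
  then show ?thesis
    by (auto simp: cos_one_2pi_int)
qed

text \<open>For a nonzero \<open>w\<close>, the equation \<open>cis (w \<bullet> v) = 1\<close>
  confines \<open>v\<close> to countably many hyperplanes. Countably many hyperplanes form a null
  set and cannot cover the whole space.\<close>

lemma ex_inner_cis_neq_1:
  fixes W :: "'a::euclidean_space set"
  assumes "countable W" "0 \<notin> W"
  shows "\<exists>v. \<forall>w\<in>W. cis (w \<bullet> v) \<noteq> 1"
proof -
  let ?H = "\<lambda>(w, k::int). {v. w \<bullet> v = 2 * pi * of_int k}"
  have "negligible (\<Union>(?H ` (W \<times> UNIV)))"
    using assms by (intro negligible_countable_Union) (auto intro!: negligible_hyperplane)
  then obtain v where "v \<notin> \<Union>(?H ` (W \<times> UNIV))"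
    by (metis non_negligible_UNIV subsetI negligible_subset)
  then show ?thesis
    using cis_eq_1_imp by fastforce
qed

section \<open>Mean values of products of powers of cosines\<close>

text \<open>This is the binomial theorem for \<open>(cis t + cis (- t)) / 2\<close>:
  \<open>k\<close> factors \<open>cis t\<close> and \<open>l - k\<close> factors
  \<open>cis (- t)\<close> have total frequency \<open>2 * k - l\<close>.\<close>

lemma cos_power_binomial:
  "complex_of_real (cos t) ^ l =
    (\<Sum>k\<in>{..l}. of_nat (l choose k) / 2 ^ l * cis ((2 * real k - real l) * t))"
proof -
  have "complex_of_real (cos t) = (cis t + cis (- t)) / 2"
    by (simp add: complex_eq_iff)
  then have "complex_of_real (cos t) ^ l = (cis t + cis (- t)) ^ l / 2 ^ l"
    by (simp only: power_divide)
  also have "\<dots> = (\<Sum>k\<in>{..l}. of_nat (l choose k) * cis t ^ k * cis (- t) ^ (l - k)) / 2 ^ l"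
    by (simp add: binomial_ring)
  also have "\<dots> = (\<Sum>k\<in>{..l}. of_nat (l choose k) / 2 ^ l * cis ((2 * real k - real l) * t))"
    unfolding sum_divide_distrib
  proof (intro sum.cong refl)
    fix k assume "k \<in> {..l}"
    then have "real k * t + real (l - k) * (- t) = (2 * real k - real l) * t"
      by (simp add: of_nat_diff algebra_simps)
    then have "cis t ^ k * cis (- t) ^ (l - k) = cis ((2 * real k - real l) * t)"
      by (simp only: Complex.DeMoivre cis_mult)
    then show "of_nat (l choose k) * cis t ^ k * cis (- t) ^ (l - k) / 2 ^ l
        = of_nat (l choose k) / 2 ^ l * cis ((2 * real k - real l) * t)"
      by (simp add: mult.assoc)
  qed
  finally show ?thesis .
qed

lemma prod_cis: "finite A \<Longrightarrow> (\<Prod>x\<in>A. cis (f x)) = cis (\<Sum>x\<in>A. f x)"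
  by (induction A rule: finite_induct) (auto simp: cis_mult)

text \<open>Multiplying out gives a finite combination of characters, one for each choice
  \<open>f\<close> of exponents. Averaging keeps only those with frequency in 2 pi Z; by
  \<open>indep\<close> these have \<open>f b\<close> equal to \<open>l div 2\<close> throughout, and
  the coefficient of that choice is the limit.\<close>

lemma prod_cos_power_mean_tendsto:
  fixes x :: "'b \<Rightarrow> real"
  assumes "finite B" "even l"
    and indep: "\<And>f. f \<in> B \<rightarrow>\<^sub>E {..l} \<Longrightarrow> cis (\<Sum>b\<in>B. (2 * real (f b) - real l) * x b) = 1 \<Longrightarrow>
      \<forall>b\<in>B. 2 * f b = l"
  shows "(\<lambda>N. (\<Sum>n<N. \<Prod>b\<in>B. cos (real n * x b) ^ l) / real N)
    \<longlonglongrightarrow> (real (l choose (l div 2)) / 2 ^ l) ^ card B"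
proof -
  let ?w = "\<lambda>f. \<Prod>b\<in>B. of_nat (l choose f b) / 2 ^ l :: complex"
  let ?z = "\<lambda>f. \<Sum>b\<in>B. (2 * real (f b) - real l) * x b"
  \<comment> \<open>The choice with zero frequency, restricted to \<open>B\<close> because the
    choices in the expansion are extensional functions.\<close>
  let ?h = "\<lambda>b\<in>B. l div 2"
  have expand: "of_real (\<Prod>b\<in>B. cos (real n * x b) ^ l) = (\<Sum>f\<in>B \<rightarrow>\<^sub>E {..l}. ?w f * cis (real n * ?z f))"
    for n
  proof -
    have "of_real (\<Prod>b\<in>B. cos (real n * x b) ^ l) =
      (\<Prod>b\<in>B. \<Sum>k\<in>{..l}. of_nat (l choose k) / 2 ^ l * cis ((2 * real k - real l) * (real n * x b)))"
      by (simp add: cos_power_binomial)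
    also have "\<dots> = (\<Sum>f\<in>B \<rightarrow>\<^sub>E {..l}. \<Prod>b\<in>B. of_nat (l choose f b) / 2 ^ l *
        cis ((2 * real (f b) - real l) * (real n * x b)))"
      using \<open>finite B\<close> by (subst prod_sum_PiE) auto
    also have "\<dots> = (\<Sum>f\<in>B \<rightarrow>\<^sub>E {..l}. ?w f * cis (real n * ?z f))"
      using \<open>finite B\<close>
      by (simp only: prod.distrib prod_cis sum_distrib_left mult.left_commute)
    finally show ?thesis .
  qed
  have "(\<lambda>N. \<Sum>f\<in>B \<rightarrow>\<^sub>E {..l}. ?w f * ((\<Sum>n<N. cis (real n * ?z f)) / of_nat N))
    \<longlonglongrightarrow> (\<Sum>f\<in>B \<rightarrow>\<^sub>E {..l}. ?w f * (if cis (?z f) = 1 then 1 else 0))"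
    by (intro tendsto_intros cis_mean_tendsto)
  also have "(\<Sum>f\<in>B \<rightarrow>\<^sub>E {..l}. ?w f * (if cis (?z f) = 1 then 1 else 0)) =
     (\<Sum>f\<in>B \<rightarrow>\<^sub>E {..l}. if f = ?h then ?w ?h else 0)"
  proof (intro sum.cong refl)
    fix f assume f: "f \<in> B \<rightarrow>\<^sub>E {..l}"
    have "f = ?h" if "cis (?z f) = 1"
      using indep[OF f that] f by (intro extensionalityI[of _ B]) (auto simp: PiE_iff)
    moreover have "cis (?z ?h) = 1"
    proof -
      have "?z ?h = 0"
        using \<open>even l\<close> by (intro sum.neutral) (auto elim!: evenE)
      then show ?thesis by simp
    qed
    ultimately have iff: "cis (?z f) = 1 \<longleftrightarrow> f = ?h"
      by (intro iffI) (assumption | simp only:)+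
    show "?w f * (if cis (?z f) = 1 then 1 else 0) = (if f = ?h then ?w ?h else 0)"
      unfolding iff by (cases "f = ?h") (simp_all only: refl if_True if_False mult_1_right mult_zero_right)
  qed
  also have "\<dots> = ?w ?h"
    using \<open>finite B\<close> by (subst sum.delta) (auto intro!: finite_PiE)
  also have "\<dots> = of_real ((real (l choose (l div 2)) / 2 ^ l) ^ card B)"
    by simp
  also have "(\<lambda>N. \<Sum>f\<in>B \<rightarrow>\<^sub>E {..l}. ?w f * ((\<Sum>n<N. cis (real n * ?z f)) / of_nat N)) =
    (\<lambda>N. of_real ((\<Sum>n<N. \<Prod>b\<in>B. cos (real n * x b) ^ l) / real N))"
  proof
    fix N
    have "(\<Sum>f\<in>B \<rightarrow>\<^sub>E {..l}. ?w f * ((\<Sum>n<N. cis (real n * ?z f)) / of_nat N)) =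
      (\<Sum>n<N. \<Sum>f\<in>B \<rightarrow>\<^sub>E {..l}. ?w f * cis (real n * ?z f)) / of_nat N"
      by (subst sum.swap) (simp add: sum_divide_distrib sum_distrib_left)
    then show "(\<Sum>f\<in>B \<rightarrow>\<^sub>E {..l}. ?w f * ((\<Sum>n<N. cis (real n * ?z f)) / of_nat N)) =
       of_real ((\<Sum>n<N. \<Prod>b\<in>B. cos (real n * x b) ^ l) / real N)"
      unfolding expand[symmetric] by simp
  qed
  finally show ?thesis
    by (simp only: tendsto_of_real_iff)
qed

section \<open>The central binomial coefficient and Wallis' product\<close>

lemma central_binomial_le:
  assumes "m > 0"
  shows "real ((2 * m) choose m) / 4 ^ m \<le> 1 / sqrt (pi * real m)"
proof -
  define c where "c = (\<lambda>m. real ((2 * m) choose m) / 4 ^ m)"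
  have c_Suc: "c (Suc m) = c m * (2 * real m + 1) / (2 * real m + 2)" for m
  proof -
    \<comment> \<open>Two absorption identities, linked by the symmetry of row
      \<open>2 * m + 1\<close> of Pascal's triangle.\<close>
    have "real (Suc m) * real ((2 * Suc m) choose Suc m) = 2 * (2 * real m + 1) * real ((2 * m) choose m)"
    proof -
      have "(Suc m) * ((2 * Suc m) choose Suc m) = (2 * Suc m) * ((2 * m + 1) choose m)"
        using Suc_times_binomial_eq[of "2 * m + 1" m] by (simp add: mult.commute)
      moreover have "(Suc m) * ((2 * m + 1) choose Suc m) = (2 * m + 1) * ((2 * m) choose m)"
        using Suc_times_binomial_eq[of "2 * m" m] by (simp add: mult.commute)
      moreover have "(2 * m + 1) choose Suc m = (2 * m + 1) choose m"
        using binomial_symmetric[of "Suc m" "2 * m + 1"] by simp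
      ultimately have "(Suc m) * ((2 * Suc m) choose Suc m) = 2 * (2 * m + 1) * ((2 * m) choose m)"
        by (simp add: algebra_simps)
      then show ?thesis
        by (metis (mono_tags, opaque_lifting) of_nat_1 of_nat_add of_nat_mult of_nat_numeral)
    qed
    then have "real ((2 * Suc m) choose Suc m) = 2 * (2 * real m + 1) * real ((2 * m) choose m) / real (Suc m)"
      by (simp only: eq_divide_eq mult.commute) simp
    moreover have "2 * p * a / q / (4 * d) = a / d * p / (2 * q)" for p a q d :: real
      by simp
    ultimately show ?thesis
      unfolding c_def by (simp only: power_Suc) (simp add: algebra_simps)
  qed
  \<comment> \<open>Thus \<open>(2 * m + 1) * c m ^ 2\<close> is the reciprocal of the partial
    Wallis product. In the induction step the new factor is
    \<open>(2 * m + 2) ^ 2 / ((2 * m + 1) * (2 * m + 3))\<close>, which cancels exactly against the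
    recursion for \<open>c\<close>.\<close>
  have wallis_eq: "(\<Prod>k=1..m. (4 * real k ^ 2) / (4 * real k ^ 2 - 1)) * ((2 * real m + 1) * c m ^ 2) = 1" for m
  proof (induction m)
    case 0
    then show ?case by (simp add: c_def)
  next
    case (Suc m)
    have "4 * real (Suc m) ^ 2 / (4 * real (Suc m) ^ 2 - 1) * ((2 * real (Suc m) + 1) * c (Suc m) ^ 2)
      = (2 * real m + 1) * c m ^ 2"
    proof -
      have a: "4 * real (Suc m) ^ 2 - 1 = (2 * real m + 1) * (2 * real m + 3)"
        "4 * real (Suc m) ^ 2 = (2 * real m + 2) ^ 2" "2 * real (Suc m) + 1 = 2 * real m + 3"
        by (auto simp: power2_eq_square algebra_simps)
      have b: "q ^ 2 / (p * s) * (s * (c m * p / q) ^ 2) = p * c m ^ 2"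
        if "p > 0" "q > 0" "s > 0" for p q s :: real
        using that by (simp add: field_simps power2_eq_square)
      show ?thesis
        unfolding a(1) unfolding a(2,3) c_Suc by (rule b) auto
    qed
    moreover have "prod f {1..Suc m} * y = prod f {1..m} * (f (Suc m) * y)"
      for f :: "nat \<Rightarrow> real" and y
      by simp
    ultimately show ?case
      using Suc by (simp only:)
  qed
  have "(\<lambda>m. real m * c m ^ 2) \<longlonglongrightarrow> 1 / 2 * inverse (pi / 2)"
  proof -
    have "(\<lambda>m. real m / (2 * real m + 1)) \<longlonglongrightarrow> 1 / 2"
      by real_asymp
    then have "(\<lambda>m. real m / (2 * real m + 1) * inverse (\<Prod>k=1..m. (4 * real k ^ 2) / (4 * real k ^ 2 - 1)))
      \<longlonglongrightarrow> 1 / 2 * inverse (pi / 2)"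
      by (intro tendsto_mult tendsto_inverse wallis) auto
    moreover have "real m / (2 * real m + 1) * inverse (\<Prod>k=1..m. (4 * real k ^ 2) / (4 * real k ^ 2 - 1)) =
        real m * c m ^ 2" for m
    proof -
      have "inverse (\<Prod>k=1..m. (4 * real k ^ 2) / (4 * real k ^ 2 - 1)) = (2 * real m + 1) * c m ^ 2"
        using wallis_eq[of m] by (rule inverse_unique)
      then show ?thesis by (simp add: add_eq_0_iff)
    qed
    ultimately show ?thesis by simp
  qed
  moreover have "incseq (\<lambda>m. real m * c m ^ 2)"
  proof (rule incseq_SucI)
    fix m
    \<comment> \<open>The right side exceeds the left by exactly \<open>m + 1\<close>.\<close>
    have "real m * (2 * real m + 2) ^ 2 \<le> real (Suc m) * (2 * real m + 1) ^ 2"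
      by (simp add: power2_eq_square algebra_simps)
    then have "real m \<le> real (Suc m) * (2 * real m + 1) ^ 2 / (2 * real m + 2) ^ 2"
      by (simp add: pos_le_divide_eq)
    then have "real m * c m ^ 2 \<le> (real (Suc m) * (2 * real m + 1) ^ 2 / (2 * real m + 2) ^ 2) * c m ^ 2"
      by (rule mult_right_mono) simp
    then show "real m * c m ^ 2 \<le> real (Suc m) * c (Suc m) ^ 2"
      by (simp add: c_Suc power_mult_distrib power_divide mult_ac)
  qed
  ultimately have "real m * c m ^ 2 \<le> 1 / pi"
    using incseq_le by force
  then have "c m ^ 2 \<le> 1 / (pi * real m)"
    using assms by (simp add: field_simps)
  then have "c m \<le> sqrt (1 / (pi * real m))"
    by (rule real_le_rsqrt)
  then show ?thesis
    by (simp add: c_def real_sqrt_divide)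
qed

section \<open>Inequalities for finite products\<close>

lemma prod_antimono_le_1:
  fixes f :: "'i \<Rightarrow> real"
  assumes "finite A" "B \<subseteq> A" "\<And>i. i \<in> A \<Longrightarrow> 0 \<le> f i" "\<And>i. i \<in> A \<Longrightarrow> f i \<le> 1"
  shows "prod f A \<le> prod f B"
  unfolding prod.subset_diff[OF assms(2,1)] using assms
  by (intro mult_left_le_one_le prod_nonneg prod_le_1) auto

text \<open>AM-GM for the powers \<open>(g i / c i) ^ card S\<close>. The weights \<open>c i\<close>
  are free; choosing them to match the limiting size of each \<open>g i\<close> makes all normalised
  means tend to 1, so this pointwise bound can replace Hoelder's inequality.\<close>

lemma prod_le_prod_mean_power:
  fixes g c :: "'i \<Rightarrow> real"
  assumes "finite S" "S \<noteq> {}" "\<And>i. i \<in> S \<Longrightarrow> 0 \<le> g i" "\<And>i. i \<in> S \<Longrightarrow> 0 < c i"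
  shows "prod g S \<le> prod c S * (\<Sum>i\<in>S. (g i / c i) ^ card S) / card S"
proof -
  let ?h = "\<lambda>i. g i / c i"
  have pos: "card S > 0" and nn: "prod ?h S \<ge> 0"
    using assms by (auto simp: card_gt_0_iff intro!: prod_nonneg divide_nonneg_pos)
  have "prod ?h S = (prod ?h S ^ card S) powr (1 / card S)"
  proof (cases "prod ?h S = 0")
    case False
    then have "prod ?h S > 0" using nn by simp
    then show ?thesis
      using pos by (simp add: powr_powr flip: powr_realpow)
  qed (use pos in \<open>simp add: power_0_left\<close>)
  also have "\<dots> = (\<Prod>i\<in>S. ?h i ^ card S) powr (1 / card S)"
    by (simp only: prod_power_distrib)
  also have "\<dots> \<le> (\<Sum>i\<in>S. ?h i ^ card S / card S)"
    using assms by (intro arith_geom_mean) (auto intro!: zero_le_power divide_nonneg_pos)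
  finally have "prod c S * prod ?h S \<le> prod c S * (\<Sum>i\<in>S. ?h i ^ card S / card S)"
    using assms by (intro mult_left_mono prod_nonneg) (auto intro: less_imp_le)
  moreover have "prod c S * prod ?h S = prod g S"
    using assms(4) by (simp flip: prod.distrib) (intro prod.cong, force+)
  ultimately show ?thesis
    by (simp flip: sum_divide_distrib)
qed

section \<open>Characteristic functions of Rademacher sums\<close>

context prob_space
begin

text \<open>The values 1 and -1 have total probability 1, so \<open>X\<close> is almost surely one
  of them and the integral is the mean of \<open>cis t\<close> and \<open>cis (- t)\<close>.\<close>

lemma expectation_cis_rademacher:
  assumes "rademacher M X"
  shows "integrable M (\<lambda>\<omega>. cis (t * X \<omega>))" "(\<integral>\<omega>. cis (t * X \<omega>) \<partial>M) = of_real (cos t)"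
proof -
  let ?P = "{\<omega> \<in> space M. X \<omega> = 1}" and ?Q = "{\<omega> \<in> space M. X \<omega> = -1}"
  have [measurable]: "X \<in> borel_measurable M" and P: "prob ?P = 1/2" and Q: "prob ?Q = 1/2"
    using assms by (auto simp: rademacher_def)
  show "integrable M (\<lambda>\<omega>. cis (t * X \<omega>))"
    by (rule integrable_const_bound[where B = 1]) (auto simp: cis_conv_exp)
  have "prob (?P \<union> ?Q) = prob ?P + prob ?Q"
    by (intro finite_measure_Union) auto
  then have "AE \<omega> in M. \<omega> \<in> ?P \<union> ?Q"
    by (intro AE_prob_1) (simp add: P Q)
  then have "(\<integral>\<omega>. cis (t * X \<omega>) \<partial>M) =
    (\<integral>\<omega>. indicator ?P \<omega> *\<^sub>R cis t + indicator ?Q \<omega> *\<^sub>R cis (- t) \<partial>M)"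
    by (intro integral_cong_AE) (auto simp: cis_conv_exp indicator_def elim!: eventually_mono)
  also have "\<dots> = prob ?P *\<^sub>R cis t + prob ?Q *\<^sub>R cis (- t)"
    by (subst Bochner_Integration.integral_add)
       (auto simp: emeasure_eq_measure)
  also have "\<dots> = of_real (cos t)"
    by (simp add: P Q complex_eq_iff)
  finally show "(\<integral>\<omega>. cis (t * X \<omega>) \<partial>M) = of_real (cos t)" .
qed

text \<open>By independence, the \<open>n\<close>-th summand is the expectation of
  \<open>cis (n * Z)\<close>, where \<open>Z\<close> is the random sum minus \<open>y\<close>. The
  averages of \<open>cis (n * Z)\<close> have norm at most 1 and converge pointwise to the indicator
  of \<open>Z\<close> being in 2 pi Z, so dominated convergence applies.\<close>

lemma rademacher_sum_mean_tendsto: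
  fixes x :: "'i \<Rightarrow> real"
  assumes "finite I" "indep_vars (\<lambda>_. borel) \<epsilon> I" "\<And>i. i \<in> I \<Longrightarrow> rademacher M (\<epsilon> i)"
  shows "(\<lambda>N. (\<Sum>n<N. cis (- real n * y) * of_real (\<Prod>i\<in>I. cos (real n * x i))) / of_nat N)
    \<longlonglongrightarrow> of_real (prob {\<omega> \<in> space M. cis ((\<Sum>i\<in>I. \<epsilon> i \<omega> * x i) - y) = 1})"
proof -
  let ?Z = "\<lambda>\<omega>. (\<Sum>i\<in>I. \<epsilon> i \<omega> * x i) - y"
  let ?s = "\<lambda>N \<omega>. (\<Sum>n<N. cis (real n * ?Z \<omega>)) / of_nat N"
  have meas [measurable]: "\<epsilon> i \<in> borel_measurable M" if "i \<in> I" for i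
    using assms(3)[OF that] by (simp add: rademacher_def)
  have Z [measurable]: "?Z \<in> borel_measurable M"
    by measurable
  have ind: "indep_vars (\<lambda>_. borel) (\<lambda>i \<omega>. cis (real n * x i * \<epsilon> i \<omega>)) I" for n
    by (rule indep_vars_compose2[OF assms(2)]) (simp add: cis_conv_exp)
  have int: "integrable M (\<lambda>\<omega>. cis (real n * x i * \<epsilon> i \<omega>))" if "i \<in> I" for n i
    by (intro expectation_cis_rademacher assms that)
  have split: "cis (real n * ?Z \<omega>) = cis (- real n * y) * (\<Prod>i\<in>I. cis (real n * x i * \<epsilon> i \<omega>))" for n \<omega>
    using \<open>finite I\<close> by (simp add: prod_cis cis_mult sum_distrib_left algebra_simps)
  have E: "(\<integral>\<omega>. cis (real n * ?Z \<omega>) \<partial>M) = cis (- real n * y) * of_real (\<Prod>i\<in>I. cos (real n * x i))"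
    for n
    unfolding split
    by (simp add: indep_vars_lebesgue_integral[OF assms(1) ind int] expectation_cis_rademacher assms(3))
  have intZ: "integrable M (\<lambda>\<omega>. cis (real n * ?Z \<omega>))" for n
    unfolding split by (intro integrable_mult_right indep_vars_integrable assms ind int)
  have "(\<lambda>N. integral\<^sup>L M (?s N)) \<longlonglongrightarrow> (\<integral>\<omega>. (if cis (?Z \<omega>) = 1 then 1 else 0) \<partial>M)"
  proof (rule integral_dominated_convergence[where w = "\<lambda>_. 1"])
    show "AE \<omega> in M. (\<lambda>N. ?s N \<omega>) \<longlonglongrightarrow> (if cis (?Z \<omega>) = 1 then 1 else 0)"
      by (intro AE_I2 cis_mean_tendsto)
    show "AE \<omega> in M. norm (?s N \<omega>) \<le> 1" for N
    proof (rule AE_I2)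
      fix \<omega>
      have "norm (\<Sum>n<N. cis (real n * ?Z \<omega>)) \<le> real N"
        using norm_sum[of "\<lambda>n. cis (real n * ?Z \<omega>)" "{..<N}"] by simp
      then show "norm (?s N \<omega>) \<le> 1"
        \<comment> \<open>The empty average is 0, as division by 0 yields 0.\<close>
        by (cases "N = 0") (auto simp: norm_divide divide_le_eq_1)
    qed
    show "?s N \<in> borel_measurable M" for N
      unfolding cis_conv_exp by measurable
    show "(\<lambda>\<omega>. if cis (?Z \<omega>) = 1 then 1 else (0::complex)) \<in> borel_measurable M"
      unfolding cis_conv_exp by measurable
  qed simp
  also have "(\<lambda>N. integral\<^sup>L M (?s N)) =
    (\<lambda>N. (\<Sum>n<N. cis (- real n * y) * of_real (\<Prod>i\<in>I. cos (real n * x i))) / of_nat N)"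
    by (simp add: integral_sum intZ E)
  also have "(\<integral>\<omega>. (if cis (?Z \<omega>) = 1 then 1 else 0) \<partial>M) =
    (\<integral>\<omega>. complex_of_real (indicator {\<omega> \<in> space M. cis (?Z \<omega>) = 1} \<omega>) \<partial>M)"
    by (intro Bochner_Integration.integral_cong) auto
  also have "\<dots> = of_real (prob {\<omega> \<in> space M. cis (?Z \<omega>) = 1})"
    by (simp add: Int_absorb2 subset_eq)
  finally show ?thesis .
qed

section \<open>The concentration bound for a fixed target\<close>

lemma rademacher_sum_concentration:
  fixes a :: "nat \<Rightarrow> 'b::euclidean_space"
  assumes l: "even l" "0 < l"
    and part: "index_partition n l A"
    and ind: "indep_vars (\<lambda>_. borel) \<epsilon> {1..n}"
    and rad: "\<And>i. i \<in> {1..n} \<Longrightarrow> rademacher M (\<epsilon> i)"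
  shows "prob {\<omega> \<in> space M. (\<Sum>i=1..n. \<epsilon> i \<omega> *\<^sub>R a i) = u}
    \<le> (real (l choose (l div 2)) / 2 ^ l) powr (real (\<Sum>j=1..l. dim (span (a ` A j))) / real l)"
proof -
  let ?r = "\<lambda>j. dim (span (a ` A j))"
  define \<mu> where "\<mu> = real (l choose (l div 2)) / 2 ^ l"
  have \<mu>: "\<mu> > 0"
    by (simp add: \<mu>_def)
  \<comment> \<open>Vectors may repeat, so the basis is recorded by indices on which
    \<open>a\<close> is injective; this keeps products over indices free of duplicate basis
    vectors.\<close>
  have "\<exists>I. I \<subseteq> A j \<and> inj_on a I \<and> independent (a ` I) \<and> card I = ?r j" for j
  proof -
    obtain B where "B \<subseteq> a ` A j" "independent B" "card B = dim (a ` A j)"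
      using basis_exists by metis
    then show ?thesis
      by (metis card_image dim_span subset_image_inj)
  qed
  then obtain I where I: "\<And>j. I j \<subseteq> A j" "\<And>j. inj_on a (I j)" "\<And>j. independent (a ` I j)"
    "\<And>j. card (I j) = ?r j"
    by metis
  have UA: "(\<Union>j\<in>{1..l}. A j) = {1..n}" and disj: "disjoint_family_on A {1..l}"
    using part by (auto simp: index_partition_def)
  have finA: "finite (A j)" if "j \<in> {1..l}" for j
    using UA that by (metis UN_upper finite_atLeastAtMost finite_subset)
  have finI: "finite (I j)" if "j \<in> {1..l}" for j
    using finA[OF that] I(1) by (rule rev_finite_subset)
  \<comment> \<open>The expansion of the powers of the cosines has these vectors as nonzero frequencies.\<close>
  define W where "W = (\<Union>j\<in>{1..l}.
    (\<lambda>f. \<Sum>b\<in>I j. (2 * real (f b) - real l) *\<^sub>R a b) ` (I j \<rightarrow>\<^sub>E {..l})) - {0}"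
  have "finite W"
    unfolding W_def using finI by (intro finite_Diff finite_UN_I finite_imageI finite_PiE) auto
  moreover have "0 \<notin> W"
    by (simp add: W_def)
  ultimately obtain v where v: "\<And>w. w \<in> W \<Longrightarrow> cis (w \<bullet> v) \<noteq> 1"
    using ex_inner_cis_neq_1 countable_finite by metis
  define x where "x i = a i \<bullet> v" for i
  define G where "G j k = (\<Prod>b\<in>I j. \<bar>cos (real k * x b)\<bar>)" for j k
  have G_lim: "(\<lambda>N. (\<Sum>k<N. G j k ^ l) / real N) \<longlonglongrightarrow> \<mu> ^ ?r j" if j: "j \<in> {1..l}" for j
  proof -
    have "(\<lambda>N. (\<Sum>k<N. \<Prod>b\<in>I j. cos (real k * x b) ^ l) / real N) \<longlonglongrightarrow> \<mu> ^ card (I j)"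
      unfolding \<mu>_def
    proof (intro prod_cos_power_mean_tendsto finI j l(1))
      fix f assume f: "f \<in> I j \<rightarrow>\<^sub>E {..l}" and "cis (\<Sum>b\<in>I j. (2 * real (f b) - real l) * x b) = 1"
      then have "cis ((\<Sum>b\<in>I j. (2 * real (f b) - real l) *\<^sub>R a b) \<bullet> v) = 1"
        by (simp add: inner_sum_left x_def)
      \<comment> \<open>The choice of \<open>v\<close> excludes
        \<open>cis (w \<bullet> v) = 1\<close> for every nonzero frequency vector \<open>w\<close>,
        so this one has to vanish.\<close>
      then have "(\<Sum>b\<in>I j. (2 * real (f b) - real l) *\<^sub>R a b) \<notin> W"
        using v by blast
      then have "(\<Sum>b\<in>I j. (2 * real (f b) - real l) *\<^sub>R a b) = 0"
        using j f unfolding W_def by blast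
      moreover have "(\<Sum>w\<in>a ` I j. (2 * real (f (the_inv_into (I j) a w)) - real l) *\<^sub>R w) =
        (\<Sum>b\<in>I j. (2 * real (f b) - real l) *\<^sub>R a b)"
        using I(2) by (simp add: sum.reindex the_inv_into_f_f)
      ultimately have "2 * real (f (the_inv_into (I j) a w)) - real l = 0" if "w \<in> a ` I j" for w
        using that
        by (intro independentD[OF I(3)[of j] finite_imageI[OF finI[OF j]] subset_refl,
              where u = "\<lambda>w. 2 * real (f (the_inv_into (I j) a w)) - real l"]) simp_all
      then have "2 * real (f b) - real l = 0" if "b \<in> I j" for b
        using that I(2)[of j] by (metis imageI the_inv_into_f_f)
      then show "\<forall>b\<in>I j. 2 * f b = l"
        by fastforce
    qed
    \<comment> \<open>Since \<open>l\<close> is even, the absolute values in \<open>G\<close>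
      disappear in the power.\<close>
    moreover have "G j k ^ l = (\<Prod>b\<in>I j. cos (real k * x b) ^ l)" for k
      using l(1) by (simp only: G_def prod_power_distrib power_even_abs)
    ultimately show ?thesis
      by (simp add: I(4))
  qed
  define K where "K = \<mu> powr (real (\<Sum>j=1..l. ?r j) / real l)"
  \<comment> \<open>The weights are \<open>\<mu> powr (?r j / l)\<close>: their \<open>l\<close>-th
    powers are the limits in \<open>G_lim\<close>, and their product is \<open>K\<close>.\<close>
  have G_prod: "(\<Prod>j=1..l. G j k) \<le> K * (\<Sum>j=1..l. G j k ^ l / \<mu> ^ ?r j) / real l" for k
  proof -
    have normalized: "(G j k / \<mu> powr (real (?r j) / real l)) ^ card {1..l} = G j k ^ l / \<mu> ^ ?r j" for j
      using \<mu> l by (simp add: power_divide powr_power powr_realpow)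
    have "(\<Prod>j=1..l. G j k) \<le> (\<Prod>j=1..l. \<mu> powr (real (?r j) / real l)) *
      (\<Sum>j=1..l. (G j k / \<mu> powr (real (?r j) / real l)) ^ card {1..l}) / real l"
      using l \<mu> prod_le_prod_mean_power[of "{1..l}" "\<lambda>j. G j k" "\<lambda>j. \<mu> powr (real (?r j) / real l)"]
      by (simp add: G_def prod_nonneg)
    also have "(\<Prod>j=1..l. \<mu> powr (real (?r j) / real l)) = K"
      using \<mu> by (simp add: K_def powr_sum sum_divide_distrib)
    finally show ?thesis
      by (simp only: normalized)
  qed
  \<comment> \<open>Cosines outside the chosen bases are at most 1 in absolute value, so dropping
    them only enlarges the product.\<close>
  have cos_prod: "(\<Prod>i=1..n. \<bar>cos (real k * x i)\<bar>) \<le> (\<Prod>j=1..l. G j k)" for k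
  proof -
    have "(\<Prod>i=1..n. \<bar>cos (real k * x i)\<bar>) = (\<Prod>j=1..l. \<Prod>i\<in>A j. \<bar>cos (real k * x i)\<bar>)"
      unfolding UA[symmetric] using finA disj
      by (intro prod.UNION_disjoint) (auto simp: disjoint_family_on_def)
    also have "\<dots> \<le> (\<Prod>j=1..l. G j k)"
      unfolding G_def using finA I(1) by (intro prod_mono conjI prod_nonneg prod_antimono_le_1) auto
    finally show ?thesis .
  qed
  let ?p = "prob {\<omega> \<in> space M. cis ((\<Sum>i=1..n. \<epsilon> i \<omega> * x i) - u \<bullet> v) = 1}"
  let ?t = "\<lambda>k. cis (- real k * (u \<bullet> v)) * of_real (\<Prod>i=1..n. cos (real k * x i))"
  have [measurable]: "\<epsilon> i \<in> borel_measurable M" if "i \<in> {1..n}" for i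
    using rad[OF that] by (simp add: rademacher_def)
  \<comment> \<open>If the sum equals \<open>u\<close>, its inner product with \<open>v\<close>
    equals \<open>u \<bullet> v\<close>, so the vector event is contained in the scalar one.\<close>
  have "prob {\<omega> \<in> space M. (\<Sum>i=1..n. \<epsilon> i \<omega> *\<^sub>R a i) = u} \<le> ?p"
  proof (rule finite_measure_mono)
    show "{\<omega> \<in> space M. cis ((\<Sum>i=1..n. \<epsilon> i \<omega> * x i) - u \<bullet> v) = 1} \<in> events"
      unfolding cis_conv_exp by measurable
  qed (auto simp: x_def inner_sum_left)
  also have "?p \<le> K"
  proof (rule LIMSEQ_le)
    show "(\<lambda>N. norm ((\<Sum>k<N. ?t k) / of_nat N)) \<longlonglongrightarrow> ?p"
      using tendsto_norm[OF rademacher_sum_mean_tendsto[OF _ ind rad, of "u \<bullet> v" x]] by simp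
    \<comment> \<open>After normalisation each of the \<open>l\<close> summands tends to 1, so the
      division by \<open>l\<close> leaves \<open>K\<close>.\<close>
    have "(\<lambda>N. K * (\<Sum>j=1..l. ((\<Sum>k<N. G j k ^ l) / real N) / \<mu> ^ ?r j) / real l)
      \<longlonglongrightarrow> K * (\<Sum>j=1..l. \<mu> ^ ?r j / \<mu> ^ ?r j) / real l"
      using \<mu> l by (intro tendsto_intros G_lim) auto
    then show "(\<lambda>N. K * (\<Sum>j=1..l. ((\<Sum>k<N. G j k ^ l) / real N) / \<mu> ^ ?r j) / real l) \<longlonglongrightarrow> K"
      using \<mu> l by simp
    have "norm ((\<Sum>k<N. ?t k) / of_nat N) \<le> K * (\<Sum>j=1..l. ((\<Sum>k<N. G j k ^ l) / real N) / \<mu> ^ ?r j) / real l"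
      for N
    proof -
      have "norm (\<Sum>k<N. ?t k) \<le> (\<Sum>k<N. norm (?t k))"
        by (rule norm_sum)
      also have "\<dots> = (\<Sum>k<N. \<Prod>i=1..n. \<bar>cos (real k * x i)\<bar>)"
        by (simp only: norm_mult norm_cis norm_of_real abs_prod mult_1_left)
      also have "\<dots> \<le> (\<Sum>k<N. K * (\<Sum>j=1..l. G j k ^ l / \<mu> ^ ?r j) / real l)"
        by (intro sum_mono order_trans[OF cos_prod G_prod])
      also have "\<dots> = K * (\<Sum>j=1..l. (\<Sum>k<N. G j k ^ l) / \<mu> ^ ?r j) / real l"
        unfolding sum_divide_distrib[of _ "{..<N}"] sum.swap[of _ "{..<N}" "{1..l}"]
        by (simp add: sum_distrib_left flip: sum_divide_distrib)
      finally have "norm (\<Sum>k<N. ?t k) / real N \<le>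
          K * (\<Sum>j=1..l. (\<Sum>k<N. G j k ^ l) / \<mu> ^ ?r j) / real l / real N"
        by (rule divide_right_mono) simp
      also have "\<dots> = K * (\<Sum>j=1..l. ((\<Sum>k<N. G j k ^ l) / real N) / \<mu> ^ ?r j) / real l"
        by (simp add: sum_divide_distrib sum_distrib_left mult_ac)
      finally show ?thesis
        by (simp only: norm_divide norm_of_nat)
    qed
    then show "\<exists>N0. \<forall>N\<ge>N0. norm ((\<Sum>k<N. ?t k) / of_nat N) \<le>
        K * (\<Sum>j=1..l. ((\<Sum>k<N. G j k ^ l) / real N) / \<mu> ^ ?r j) / real l"
      by blast
  qed
  finally show ?thesis
    by (simp only: K_def \<mu>_def)
qed

end

section \<open>The supremum bound and its asymptotic form\<close>

theorem theorem1p11: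
  "\<exists>C::real. 0 \<le> C \<and>
    (\<forall>(l::nat) (r::nat \<Rightarrow> nat). even l \<and> 0 < l \<longrightarrow>
      (\<forall>(n::nat) (a::nat \<Rightarrow> real^'d) (A::nat \<Rightarrow> nat set) (M::'m measure) (\<epsilon>::nat \<Rightarrow> 'm \<Rightarrow> real).
         index_partition n l A \<and>
         (\<forall>j\<in>{1..l}. r j = dim (span (a ` A j))) \<and>
         prob_space M \<and>
         prob_space.indep_vars M (\<lambda>_. borel) \<epsilon> {1..n} \<and>
         (\<forall>i\<in>{1..n}. rademacher M (\<epsilon> i)) \<longrightarrow>
         (SUP u::real^'d. measure M {\<omega> \<in> space M. (\<Sum>i=1..n. \<epsilon> i \<omega> *\<^sub>R a i) = u})
           \<le> (2 powr (- real l) * real (l choose (l div 2))) powr (real (\<Sum>j=1..l. r j) / real l)) \<and>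
      (2 powr (- real l) * real (l choose (l div 2))) powr (real (\<Sum>j=1..l. r j) / real l)
        \<le> (sqrt (2 / (pi * real l)) * (1 + C / real l)) powr (real (\<Sum>j=1..l. r j) / real l))"
proof (intro exI[of _ 0] conjI allI impI)
  fix l :: nat and r :: "nat \<Rightarrow> nat"
  assume l: "even l \<and> 0 < l"
  have base: "2 powr (- real l) * real (l choose (l div 2)) = real (l choose (l div 2)) / 2 ^ l"
    by (simp add: powr_minus powr_realpow divide_inverse)
  show "(2 powr (- real l) * real (l choose (l div 2))) powr (real (\<Sum>j=1..l. r j) / real l)
      \<le> (sqrt (2 / (pi * real l)) * (1 + 0 / real l)) powr (real (\<Sum>j=1..l. r j) / real l)"
  proof (rule powr_mono2)
    \<comment> \<open>With \<open>l = 2 * m\<close>, the normaliser \<open>2 ^ l\<close> becomes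
      \<open>4 ^ m\<close> and \<open>2 / (pi * l)\<close> becomes
      \<open>1 / (pi * m)\<close>.\<close>
    obtain m where m: "l = 2 * m" "m > 0"
      using l by auto
    have "real ((2 * m) choose m) / 2 ^ (2 * m) \<le> 1 / sqrt (pi * real m)"
      using central_binomial_le[OF m(2)] by (simp add: power_mult)
    also have "\<dots> = sqrt (2 / (pi * real (2 * m)))"
      by (simp add: real_sqrt_divide)
    finally show "2 powr (- real l) * real (l choose (l div 2)) \<le> sqrt (2 / (pi * real l)) * (1 + 0 / real l)"
      unfolding base unfolding m(1) by simp
  qed (auto intro!: divide_nonneg_nonneg sum_nonneg)
  fix n :: nat and a :: "nat \<Rightarrow> real^'d" and A :: "nat \<Rightarrow> nat set"
    and M :: "'m measure" and \<epsilon> :: "nat \<Rightarrow> 'm \<Rightarrow> real"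
  assume H: "index_partition n l A \<and>
         (\<forall>j\<in>{1..l}. r j = dim (span (a ` A j))) \<and>
         prob_space M \<and>
         prob_space.indep_vars M (\<lambda>_. borel) \<epsilon> {1..n} \<and>
         (\<forall>i\<in>{1..n}. rademacher M (\<epsilon> i))"
  then interpret prob_space M by blast
  have "(\<Sum>j=1..l. r j) = (\<Sum>j=1..l. dim (span (a ` A j)))"
    using H by simp
  then show "(SUP u::real^'d. measure M {\<omega> \<in> space M. (\<Sum>i=1..n. \<epsilon> i \<omega> *\<^sub>R a i) = u})
      \<le> (2 powr (- real l) * real (l choose (l div 2))) powr (real (\<Sum>j=1..l. r j) / real l)"
    unfolding base using H l by (intro cSUP_least)
      (simp_all only: rademacher_sum_concentration UNIV_not_empty simp_thms)
qed simp

end
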